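(* Let $X$ be a cyclic quandle of order $q\ge 3$, with standard generators $x,y$, and let $\phi:X\to\mathrm{Conj}(\mathrm{Aut}(\mathbb{C}^2))$ be a non-constant representation. Put $A=\phi(x)$ and $B=\phi(y)$. Then $\phi$ is irreducible, or $A^{q-1}$ and $B^{q-1}$ are multiples of the identity.
   Context: A quandle is a set $X$ with a binary operation $\triangleright$ such that every right multiplication $R_i:y\mapsto y\triangleright i$ is a bijection, $(x\triangleright y)\triangleright z=(x\triangleright z)\triangleright(y\triangleright z)$, and $x\triangleright x=x$. A finite quandle $X$ of cardinality $q>2$ is cyclic if every $R_i$ is a cycle of length $q-1$. Every cyclic quandle of order $q$ is isomorphic to an Alexander quandle $(\mathbb{F}_q,\alpha)$ ($q$ a prime power, $\alpha$ a primitive element of $\mathbb{F}_q$, operation $u\triangleright v=\alpha u+(1-\alpha)v$), equivalently to the quandle with generators $x,y$ and relations $ab^{q-1}=a$, $ab^k=ba^{\log_\alpha(1-\alpha^k)}$ for $(a,b)\in\{(x,y),(y,x)\}$, $1\le k\le q-2$; here $ab^k=(\cdots((a\triangleright b)\triangleright b)\cdots)\triangleright b$ ($k$ factors $b$) and $\log_\alpha r\in\{0,\dots,q-2\}$ satisfies $\alpha^{\log_\alpha r}=r$. The standard generators of $X$ are the elements corresponding to $x,y$ under such an isomorphism (in $(\mathbb{F}_q,\alpha)$ they are $0$ and $1$). $\mathrm{Conj}(G)$ is the group $G$ with quandle operation $g\triangleright h=hgh^{-1}$; a representation of $X$ on $V$ is a quandle homomorphism $X\to\mathrm{Conj}(\mathrm{Aut}(V))$.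 A subrepresentation is a linear subspace invariant under all $\phi(z)$, $z\in X$; $\phi$ is irreducible if its only subrepresentations are $\{0\}$ and $V$. *)

theory Defs
  imports
    "HOL-Analysis.Analysis"
    "HOL-Algebra.Multiplicative_Group"
    "HOL-Algebra.Weak_Morphisms"
    "HOL-Combinatorics.Cycles"
begin

section \<open>Quandles\<close>

record 'a quandle = "'a partial_object" +
  qop :: "'a \<Rightarrow> 'a \<Rightarrow> 'a"  (infixl \<open>\<triangleright>\<index>\<close> 70)

locale quandle =
  fixes X (structure)
  assumes closed: "\<lbrakk>a \<in> carrier X; b \<in> carrier X\<rbrakk> \<Longrightarrow> a \<triangleright> b \<in> carrier X"
    and bij: "i \<in> carrier X \<Longrightarrow> bij_betw (\<lambda>a. a \<triangleright> i) (carrier X) (carrier X)"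
    and distrib: "\<lbrakk>a \<in> carrier X; b \<in> carrier X; c \<in> carrier X\<rbrakk>
                    \<Longrightarrow> (a \<triangleright> b) \<triangleright> c = (a \<triangleright> c) \<triangleright> (b \<triangleright> c)"
    and idem: "a \<in> carrier X \<Longrightarrow> a \<triangleright> a = a"

definition quandle_hom :: "('a, 'm) quandle_scheme \<Rightarrow> ('b, 'n) quandle_scheme \<Rightarrow> ('a \<Rightarrow> 'b) set" where
  "quandle_hom X Y =
     {f \<in> carrier X \<rightarrow> carrier Y. \<forall>a\<in>carrier X. \<forall>b\<in>carrier X. f (a \<triangleright>\<^bsub>X\<^esub> b) = f a \<triangleright>\<^bsub>Y\<^esub> f b}"

definition quandle_iso :: "('a, 'm) quandle_scheme \<Rightarrow> ('b, 'n) quandle_scheme \<Rightarrow> ('a \<Rightarrow> 'b) set" where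
  "quandle_iso X Y = {f \<in> quandle_hom X Y. bij_betw f (carrier X) (carrier Y)}"

locale cyclic_quandle = quandle +
  assumes finite_carrier: "finite (carrier X)"
    and card_gt_2: "card (carrier X) > 2"
    and cyclic: "i \<in> carrier X \<Longrightarrow>
      \<exists>cs. cycle cs \<and> set cs \<subseteq> carrier X \<and> length cs = card (carrier X) - 1 \<and>
           (\<forall>a\<in>carrier X. a \<triangleright> i = cycle_of_list cs a)"

definition alexander_quandle :: "('a, 'm) ring_scheme \<Rightarrow> 'a \<Rightarrow> 'a quandle" where
  "alexander_quandle F \<alpha> =
     \<lparr>carrier = carrier F,
      qop = (\<lambda>u v. \<alpha> \<otimes>\<^bsub>F\<^esub> u \<oplus>\<^bsub>F\<^esub> (\<one>\<^bsub>F\<^esub> \<ominus>\<^bsub>F\<^esub> \<alpha>) \<otimes>\<^bsub>F\<^esub> v)\<rparr>"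

definition primitive_element :: "('a, 'm) ring_scheme \<Rightarrow> 'a \<Rightarrow> bool" where
  "primitive_element F \<alpha> \<longleftrightarrow>
     \<alpha> \<in> carrier (mult_of F) \<and> generate (mult_of F) {\<alpha>} = carrier (mult_of F)"

text \<open>
  HOL cannot quantify existentially over the carrier type of the field, so it is taken to be
  \<^typ>\<open>nat\<close>. This loses nothing, as every finite field is isomorphic to one carried by a set of
  natural numbers; see \<open>standard_generatorsI\<close> below.
\<close>

definition standard_generators :: "('a, 'm) quandle_scheme \<Rightarrow> 'a \<Rightarrow> 'a \<Rightarrow> bool" where
  "standard_generators X x y \<longleftrightarrow>
     (\<exists>(F :: nat ring) \<alpha> f. field F \<and> finite (carrier F) \<and> primitive_element F \<alpha> \<and>
        f \<in> quandle_iso (alexander_quandle F \<alpha>) X \<and> f \<zero>\<^bsub>F\<^esub> = x \<and> f \<one>\<^bsub>F\<^esub> = y)"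

lemma standard_generatorsI:
  fixes F :: "('b, 'n) ring_scheme"
  assumes F: "field F" and fin: "finite (carrier F)" and prim: "primitive_element F \<alpha>"
    and f: "f \<in> quandle_iso (alexander_quandle F \<alpha>) X"
  shows "standard_generators X (f \<zero>\<^bsub>F\<^esub>) (f \<one>\<^bsub>F\<^esub>)"
proof -
  interpret F: field F by (rule F)
  obtain g :: "'b \<Rightarrow> nat" where inj: "inj_on g (carrier F)"
    using fin finite_imp_inj_to_nat_seg by blast
  define N where "N = image_ring g F"
  define h where "h = inv_into (carrier F) g"
  have iso: "g \<in> ring_iso F N"
    unfolding N_def by (rule inj_imp_image_ring_iso[OF inj])
  interpret N: field N
    unfolding N_def by (rule F.inj_imp_image_ring_is_field[OF inj])
  interpret g: ring_hom_ring F N g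
    using iso F.ring_axioms N.ring_axioms by (auto intro: ring_hom_ringI2 simp: ring_iso_def)
  have carr: "carrier N = g ` carrier F"
    by (simp add: N_def image_ring_carrier)
  have hg: "h (g a) = a" if "a \<in> carrier F" for a
    using that inj by (simp add: h_def)
  have \<alpha>: "\<alpha> \<in> carrier F" "\<alpha> \<noteq> \<zero>\<^bsub>F\<^esub>"
    using prim by (auto simp: primitive_element_def)
  have img: "g ` carrier (mult_of F) = carrier (mult_of N)"
    using inj_on_image_set_diff[OF inj, of "carrier F" "{\<zero>\<^bsub>F\<^esub>}"] carr by simp
  have hom: "g \<in> hom (mult_of F) (mult_of N)"
    using img by (intro homI) auto
  interpret gm: group_hom "mult_of F" "mult_of N" g
    using hom F.field_mult_group N.field_mult_group
    by (simp add: group_hom_def group_hom_axioms_def)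
  have "generate (mult_of N) {g \<alpha>} = g ` generate (mult_of F) {\<alpha>}"
    using gm.generate_img[of "{\<alpha>}"] \<alpha> by simp
  then have primN: "primitive_element N (g \<alpha>)"
    using prim img by (auto simp: primitive_element_def)
  have "f \<circ> h \<in> quandle_iso (alexander_quandle N (g \<alpha>)) X"
  proof -
    have f': "f \<in> carrier F \<rightarrow> carrier X" "bij_betw f (carrier F) (carrier X)"
      "\<And>a b. \<lbrakk>a \<in> carrier F; b \<in> carrier F\<rbrakk> \<Longrightarrow>
         f (\<alpha> \<otimes>\<^bsub>F\<^esub> a \<oplus>\<^bsub>F\<^esub> (\<one>\<^bsub>F\<^esub> \<ominus>\<^bsub>F\<^esub> \<alpha>) \<otimes>\<^bsub>F\<^esub> b) = f a \<triangleright>\<^bsub>X\<^esub> f b"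
      using f by (auto simp: quandle_iso_def quandle_hom_def alexander_quandle_def)
    have "bij_betw h (carrier N) (carrier F)"
      unfolding h_def carr by (intro bij_betw_inv_into inj_on_imp_bij_betw inj)
    then have "bij_betw (f \<circ> h) (carrier N) (carrier X)"
      using f'(2) by (rule bij_betw_trans)
    moreover have "(f \<circ> h) (g \<alpha> \<otimes>\<^bsub>N\<^esub> a \<oplus>\<^bsub>N\<^esub> (\<one>\<^bsub>N\<^esub> \<ominus>\<^bsub>N\<^esub> g \<alpha>) \<otimes>\<^bsub>N\<^esub> b) = (f \<circ> h) a \<triangleright>\<^bsub>X\<^esub> (f \<circ> h) b"
      if "a \<in> carrier N" "b \<in> carrier N" for a b
    proof -
      obtain a' b' where ab: "a = g a'" "b = g b'" "a' \<in> carrier F" "b' \<in> carrier F"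
        using \<open>a \<in> carrier N\<close> \<open>b \<in> carrier N\<close> carr by auto
      have eq: "g \<alpha> \<otimes>\<^bsub>N\<^esub> a \<oplus>\<^bsub>N\<^esub> (\<one>\<^bsub>N\<^esub> \<ominus>\<^bsub>N\<^esub> g \<alpha>) \<otimes>\<^bsub>N\<^esub> b
          = g (\<alpha> \<otimes>\<^bsub>F\<^esub> a' \<oplus>\<^bsub>F\<^esub> (\<one>\<^bsub>F\<^esub> \<ominus>\<^bsub>F\<^esub> \<alpha>) \<otimes>\<^bsub>F\<^esub> b')"
        using ab \<alpha> by (simp add: a_minus_def)
      then show ?thesis
        unfolding comp_apply eq
        using ab \<alpha> f'(3) hg[of a'] hg[of b']
          hg[of "\<alpha> \<otimes>\<^bsub>F\<^esub> a' \<oplus>\<^bsub>F\<^esub> (\<one>\<^bsub>F\<^esub> \<ominus>\<^bsub>F\<^esub> \<alpha>) \<otimes>\<^bsub>F\<^esub> b'"]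
        by (simp del: g.hom_add g.hom_mult)
    qed
    ultimately show ?thesis
      by (auto simp: quandle_iso_def quandle_hom_def alexander_quandle_def bij_betw_def)
  qed
  moreover have "(f \<circ> h) \<zero>\<^bsub>N\<^esub> = f \<zero>\<^bsub>F\<^esub>" "(f \<circ> h) \<one>\<^bsub>N\<^esub> = f \<one>\<^bsub>F\<^esub>"
    using hg[of "\<zero>\<^bsub>F\<^esub>"] hg[of "\<one>\<^bsub>F\<^esub>"] by simp_all
  ultimately show ?thesis
    unfolding standard_generators_def
    using N.field_axioms primN fin carr by (intro exI[of _ N] exI[of _ "g \<alpha>"] exI[of _ "f \<circ> h"]) simp
qed


section \<open>Representations\<close>

definition Conj :: "('a, 'm) monoid_scheme \<Rightarrow> 'a quandle" where
  "Conj G = \<lparr>carrier = carrier G, qop = (\<lambda>g h. h \<otimes>\<^bsub>G\<^esub> g \<otimes>\<^bsub>G\<^esub> inv\<^bsub>G\<^esub> h)\<rparr>"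

text \<open>
  A vector space is given by its scalar multiplication \<open>s\<close> on a type \<open>'v\<close>.
\<close>

definition Aut :: "('k::field \<Rightarrow> 'v::ab_group_add \<Rightarrow> 'v) \<Rightarrow> ('v \<Rightarrow> 'v) monoid" where
  "Aut s = \<lparr>carrier = {g. Vector_Spaces.linear s s g \<and> bij g}, mult = (\<circ>), one = id\<rparr>"

lemma group_Aut:
  assumes "vector_space s"
  shows "group (Aut s)"
proof -
  interpret vector_space s by fact
  interpret vector_space_pair s s ..
  show ?thesis
  proof (rule groupI)
    fix g assume g: "g \<in> carrier (Aut s)"
    then have lin: "Vector_Spaces.linear s s g" and bij: "bij g"
      by (auto simp: Aut_def)
    obtain h where h: "Vector_Spaces.linear s s h" "h \<circ> g = id"
      using linear_injective_left_inverse[OF lin bij_is_inj[OF bij]] by blast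
    have "h = Hilbert_Choice.inv g"
      using h(2) bij by (metis bij_is_surj comp_id fun.map_comp id_comp surj_iff)
    with h bij show "\<exists>h\<in>carrier (Aut s). h \<otimes>\<^bsub>Aut s\<^esub> g = \<one>\<^bsub>Aut s\<^esub>"
      by (intro bexI[of _ h]) (auto simp: Aut_def bij_imp_bij_inv)
  qed (auto simp: Aut_def linear_id comp_assoc intro: bij_comp Vector_Spaces.linear_compose)
qed

definition quandle_rep ::
    "('a, 'm) quandle_scheme \<Rightarrow> ('k::field \<Rightarrow> 'v::ab_group_add \<Rightarrow> 'v) \<Rightarrow> ('a \<Rightarrow> 'v \<Rightarrow> 'v) \<Rightarrow> bool" where
  "quandle_rep X s \<phi> \<longleftrightarrow> \<phi> \<in> quandle_hom X (Conj (Aut s))"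

definition subrep ::
    "('a, 'm) quandle_scheme \<Rightarrow> ('k::field \<Rightarrow> 'v::ab_group_add \<Rightarrow> 'v) \<Rightarrow> ('a \<Rightarrow> 'v \<Rightarrow> 'v) \<Rightarrow> 'v set \<Rightarrow> bool" where
  "subrep X s \<phi> W \<longleftrightarrow> Modules.module.subspace s W \<and> (\<forall>z\<in>carrier X. \<phi> z ` W \<subseteq> W)"

definition irreducible_rep ::
    "('a, 'm) quandle_scheme \<Rightarrow> ('k::field \<Rightarrow> 'v::ab_group_add \<Rightarrow> 'v) \<Rightarrow> ('a \<Rightarrow> 'v \<Rightarrow> 'v) \<Rightarrow> bool" where
  "irreducible_rep X s \<phi> \<longleftrightarrow> (\<forall>W. subrep X s \<phi> W \<longrightarrow> W = {0} \<or> W = UNIV)"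

end

theory Submission
  imports Defs
begin

text \<open>
  Put \<open>n = q - 1\<close>. Since every right multiplication \<open>R\<^sub>z\<close> has order \<open>n\<close>, the map \<open>\<phi> z ^^ n\<close> commutes
  with the whole image of \<open>\<phi>\<close>. The centralizer of a non-scalar \<open>2 \<times> 2\<close> matrix is commutative,
  so if \<open>\<phi> z ^^ n\<close> were not scalar, all the \<open>\<phi> u\<close> would commute; then \<open>\<phi> (u \<triangleright> v) = \<phi> u\<close>, and
  connectedness of the quandle forces \<open>\<phi>\<close> to be constant. Hence the second alternative holds
  even for irreducible \<open>\<phi>\<close>.
\<close>

section \<open>Centralizers in dimension two\<close>

text \<open>The centralizer of a non-scalar \<open>M\<close> consists of the matrices
  \<open>k * M + scalar\<close>, which commute with each other. So a matrix commuting with two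
  non-commuting ones is scalar.\<close>

lemma commuting_matrices_2:
  fixes M S T :: "'a::field ^ 2 ^ 2"
  assumes "M ** S = S ** M" "M ** T = T ** M" "S ** T \<noteq> T ** S"
  shows "\<exists>c. M = mat c"
proof -
  \<comment> \<open>The three minors expressing that the triples (entry 12, entry 21, difference of
    the diagonal entries) of \<open>M\<close> and \<open>S\<close> are parallel. Up to sign they are
    entries of the commutator.\<close>
  let ?P = "\<lambda>S::'a^2^2. M$1$2 * S$2$1 = S$1$2 * M$2$1 \<and>
    M$1$2 * (S$1$1 - S$2$2) = S$1$2 * (M$1$1 - M$2$2) \<and>
    M$2$1 * (S$1$1 - S$2$2) = S$2$1 * (M$1$1 - M$2$2)"
  have comm: "?P S" if "M ** S = S ** M" for S
  proof -
    have "M$1$2 * S$2$1 = S$1$2 * M$2$1"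
        "M$1$1 * S$1$2 + M$1$2 * S$2$2 = S$1$1 * M$1$2 + S$1$2 * M$2$2"
        "M$2$1 * S$1$1 + M$2$2 * S$2$1 = S$2$1 * M$1$1 + S$2$2 * M$2$1"
      using that by (simp_all add: vec_eq_iff matrix_matrix_mult_def UNIV_2 forall_2)
    then show ?thesis
      by (simp add: algebra_simps)
  qed
  have S: "?P S" and T: "?P T"
    using comm assms(1,2) by blast+
  have "\<not> (M$1$2 \<noteq> 0 \<or> M$2$1 \<noteq> 0 \<or> M$1$1 - M$2$2 \<noteq> 0)"
  proof
    assume nonscalar: "M$1$2 \<noteq> 0 \<or> M$2$1 \<noteq> 0 \<or> M$1$1 - M$2$2 \<noteq> 0"
    \<comment> \<open>\<open>k\<close> is the ratio of the two triples at a coordinate where that of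
      \<open>M\<close> does not vanish.\<close>
    have par: "\<exists>k. S$1$2 = k * M$1$2 \<and> S$2$1 = k * M$2$1 \<and> S$1$1 = S$2$2 + k * (M$1$1 - M$2$2)"
      if P: "?P S" for S
    proof -
      consider "M$1$2 \<noteq> 0" | "M$2$1 \<noteq> 0" | "M$1$1 - M$2$2 \<noteq> 0"
        using nonscalar by blast
      then show ?thesis
      proof cases
        case 1
        then show ?thesis
          using P by (intro exI[of _ "S$1$2 / M$1$2"]) (simp add: field_simps)
      next
        case 2
        then show ?thesis
          using P by (intro exI[of _ "S$2$1 / M$2$1"]) (simp add: field_simps)
      next
        case 3
        then show ?thesis
          using P by (intro exI[of _ "(S$1$1 - S$2$2) / (M$1$1 - M$2$2)"])
            (simp add: nonzero_eq_divide_eq mult.commute)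
      qed
    qed
    obtain k l where "S$1$2 = k * M$1$2" "S$2$1 = k * M$2$1" "S$1$1 = S$2$2 + k * (M$1$1 - M$2$2)"
        "T$1$2 = l * M$1$2" "T$2$1 = l * M$2$1" "T$1$1 = T$2$2 + l * (M$1$1 - M$2$2)"
      using par[OF S] par[OF T] by blast
    then have "S ** T = T ** S"
      by (simp add: vec_eq_iff matrix_matrix_mult_def UNIV_2 forall_2) (simp add: algebra_simps)
    then show False
      using assms(3) by blast
  qed
  then have "M = mat (M$1$1)"
    by (auto simp: vec_eq_iff mat_def forall_2)
  then show ?thesis ..
qed

lemma commuting_linear_2:
  fixes f g h :: "'a::field ^ 2 \<Rightarrow> 'a ^ 2"
  assumes lin: "Vector_Spaces.linear (*s) (*s) f" "Vector_Spaces.linear (*s) (*s) g"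
      "Vector_Spaces.linear (*s) (*s) h"
    and comm: "f \<circ> g = g \<circ> f" "f \<circ> h = h \<circ> f" "g \<circ> h \<noteq> h \<circ> g"
  shows "\<exists>c. f = (\<lambda>v. c *s v)"
proof -
  have "matrix g ** matrix h \<noteq> matrix h ** matrix g"
  proof
    assume "matrix g ** matrix h = matrix h ** matrix g"
    then have "matrix g *v (matrix h *v v) = matrix h *v (matrix g *v v)" for v
      by (simp add: matrix_vector_mul_assoc)
    with comm(3) lin show False
      by (simp add: fun_eq_iff matrix_works)
  qed
  moreover have "matrix f ** matrix g = matrix g ** matrix f"
      "matrix f ** matrix h = matrix h ** matrix f"
    using lin comm(1,2) by (metis matrix_compose_gen)+
  ultimately obtain c where "matrix f = mat c"
    using commuting_matrices_2 by blast
  then have "f v = c *s v" for v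
    using matrix_works[OF lin(1), of v]
    \<comment> \<open>Moving the product inside the conditional from \<open>mat_def\<close> leaves a
      sum with a single nonzero term.\<close>
    by (simp add: vec_eq_iff matrix_vector_mult_def mat_def if_distrib[of "\<lambda>a. a * _"] cong: if_cong)
  then show ?thesis
    by blast
qed

lemma linear_funpow:
  assumes "vector_space s" "Vector_Spaces.linear s s f"
  shows "Vector_Spaces.linear s s (f ^^ n)"
proof (induction n)
  case 0
  then show ?case
    using vector_space.linear_id[OF assms(1)] by (simp add: id_def)
next
  case (Suc n)
  then show ?case
    using Vector_Spaces.linear_compose[OF Suc assms(2)] by (simp add: comp_def)
qed

section \<open>Orbits of right multiplications\<close>

lemma (in quandle) rmult_funpow_closed:
  assumes "a \<in> carrier X" "i \<in> carrier X"
  shows "((\<lambda>a. a \<triangleright> i) ^^ n) a \<in> carrier X"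
  using assms by (induction n) (auto intro: closed)

context cyclic_quandle
begin

lemma rmult_funpow_eq_cycle:
  assumes "i \<in> carrier X" "a \<in> carrier X" "\<forall>a\<in>carrier X. a \<triangleright> i = cycle_of_list cs a"
  shows "((\<lambda>a. a \<triangleright> i) ^^ n) a = (cycle_of_list cs ^^ n) a"
proof (induction n)
  case 0
  then show ?case by simp
next
  case (Suc n)
  then show ?case
    using assms(3) rmult_funpow_closed[OF assms(2,1), of n] by simp
qed

text \<open>On the carrier, right multiplication by \<open>i\<close> agrees with a cycle of length
  \<open>card (carrier X) - 1\<close>, whose power to its own length is the identity.\<close>

lemma rmult_funpow_card:
  assumes "i \<in> carrier X" "a \<in> carrier X"
  shows "((\<lambda>a. a \<triangleright> i) ^^ (card (carrier X) - 1)) a = a"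
proof -
  obtain cs where cs: "cycle cs" "length cs = card (carrier X) - 1"
      "\<forall>a\<in>carrier X. a \<triangleright> i = cycle_of_list cs a"
    using cyclic[OF assms(1)] by blast
  show ?thesis
    using rmult_funpow_eq_cycle[OF assms cs(3), of "length cs"] cycle_is_id_root[OF cs(1)] cs(2)
    by simp
qed

text \<open>The fixed point \<open>i\<close> cannot lie on the cycle, so by counting the cycle runs
  through all other elements.\<close>

lemma rmult_transitive:
  assumes i: "i \<in> carrier X" and a: "a \<in> carrier X - {i}" and b: "b \<in> carrier X - {i}"
  obtains n where "((\<lambda>a. a \<triangleright> i) ^^ n) a = b"
proof -
  obtain cs where cs: "cycle cs" "set cs \<subseteq> carrier X" "length cs = card (carrier X) - 1"
      "\<forall>a\<in>carrier X. a \<triangleright> i = cycle_of_list cs a"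
    using cyclic[OF i] by blast
  let ?c = "cycle_of_list cs"
  have len: "length cs \<ge> 2"
    using cs(3) card_gt_2 by simp
  \<comment> \<open>Applying the cycle \<open>n\<close> times to every entry rotates the list by
    \<open>n\<close> places.\<close>
  have pow: "(?c ^^ n) (cs ! k) = cs ! ((n + k) mod length cs)" if "k < length cs" for n k
    using that cyclic_rotation[OF cs(1), of n]
    by (metis nth_map nth_rotate)
  \<comment> \<open>Idempotence fixes \<open>i\<close>, whereas a cycle of length at least 2 moves
    each of its entries.\<close>
  have "i \<notin> set cs"
  proof
    assume "i \<in> set cs"
    then obtain k where k: "k < length cs" "cs ! k = i"
      by (auto simp: in_set_conv_nth)
    have "cs ! ((1 + k) mod length cs) = cs ! k"
      using pow[OF k(1), of 1] cs(4) i idem[OF i] k(2) by simp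
    moreover have "(1 + k) mod length cs < length cs"
      using len by (intro mod_less_divisor) linarith
    ultimately have "(1 + k) mod length cs = k"
      using cs(1) k(1) by (simp only: nth_eq_iff_index_eq)
    then show False
      using k(1) len by (cases "1 + k = length cs") auto
  qed
  then have "set cs \<subseteq> carrier X - {i}"
    using cs(2) by blast
  moreover have "card (set cs) = card (carrier X - {i})"
    using cs(1,3) i finite_carrier by (simp add: distinct_card)
  ultimately have set: "set cs = carrier X - {i}"
    using finite_carrier by (intro card_subset_eq) auto
  obtain k l where k: "k < length cs" "cs ! k = a" and l: "l < length cs" "cs ! l = b"
    using a b unfolding set[symmetric] in_set_conv_nth by blast
  \<comment> \<open>The shift is \<open>l - k\<close> plus one full turn, so that natural
    subtraction does not truncate when \<open>l < k\<close>.\<close>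
  have "(?c ^^ (l + (length cs - k))) a = b"
    using pow[OF k(1), of "l + (length cs - k)"] k l by simp
  then show ?thesis
    using that rmult_funpow_eq_cycle[OF i _ cs(4)] a by auto
qed

text \<open>With more than two elements, any \<open>a\<close> and \<open>b\<close> avoid some third
  element \<open>i\<close>, and then right multiplication by \<open>i\<close> carries
  \<open>a\<close> to \<open>b\<close> after some iterations.\<close>

lemma constant_on_if_rmult_invariant:
  assumes inv: "\<And>a i. \<lbrakk>a \<in> carrier X; i \<in> carrier X\<rbrakk> \<Longrightarrow> \<phi> (a \<triangleright> i) = \<phi> a"
  shows "\<phi> constant_on carrier X"
proof -
  have pow: "\<phi> (((\<lambda>a. a \<triangleright> i) ^^ n) a) = \<phi> a" if "a \<in> carrier X" "i \<in> carrier X" for a i n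
    using that by (induction n) (auto simp: inv rmult_funpow_closed)
  have "\<phi> a = \<phi> b" if ab: "a \<in> carrier X" "b \<in> carrier X" for a b
  proof -
    have "\<not> carrier X \<subseteq> {a, b}"
    proof
      assume "carrier X \<subseteq> {a, b}"
      then have "card (carrier X) \<le> card {a, b}"
        by (intro card_mono) auto
      then show False
        using card_gt_2 card_insert_le_m1[of 2 "{b}" a] by simp
    qed
    then obtain i where "i \<in> carrier X" "i \<noteq> a" "i \<noteq> b"
      by blast
    with ab obtain n where "((\<lambda>a. a \<triangleright> i) ^^ n) a = b"
      using rmult_transitive[of i a b] by blast
    then show ?thesis
      using pow[OF ab(1) \<open>i \<in> carrier X\<close>, of n] by simp
  qed
  then show ?thesis
    unfolding constant_on_def by blast
qed

end

section \<open>Representations and powers of their values\<close>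

text \<open>The conjugation formula multiplied on the right by \<open>\<phi> i\<close>, which
  removes the inverse taken in \<open>Aut s\<close>.\<close>

lemma quandle_rep_intertwine:
  assumes "vector_space s" "quandle_rep X s \<phi>" "a \<in> carrier X" "i \<in> carrier X"
  shows "\<phi> (a \<triangleright>\<^bsub>X\<^esub> i) \<circ> \<phi> i = \<phi> i \<circ> \<phi> a"
proof -
  interpret G: group "Aut s"
    by (rule group_Aut[OF assms(1)])
  have "\<phi> a \<in> carrier (Aut s)" "\<phi> i \<in> carrier (Aut s)"
      "\<phi> (a \<triangleright>\<^bsub>X\<^esub> i) = \<phi> i \<otimes>\<^bsub>Aut s\<^esub> \<phi> a \<otimes>\<^bsub>Aut s\<^esub> inv\<^bsub>Aut s\<^esub> \<phi> i"
    using assms(2-4) by (auto simp: quandle_rep_def quandle_hom_def Conj_def)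
  then have "\<phi> (a \<triangleright>\<^bsub>X\<^esub> i) \<otimes>\<^bsub>Aut s\<^esub> \<phi> i = \<phi> i \<otimes>\<^bsub>Aut s\<^esub> \<phi> a"
    by (simp add: G.m_assoc)
  then show ?thesis
    by (simp add: Aut_def)
qed

text \<open>Once the iterated right multiplication returns to \<open>a\<close>, this says that
  \<open>\<phi> i ^^ n\<close> commutes with \<open>\<phi> a\<close>.\<close>

lemma quandle_rep_intertwine_funpow:
  assumes "quandle X" "vector_space s" "quandle_rep X s \<phi>" "a \<in> carrier X" "i \<in> carrier X"
  shows "\<phi> (((\<lambda>a. a \<triangleright>\<^bsub>X\<^esub> i) ^^ n) a) \<circ> (\<phi> i ^^ n) = (\<phi> i ^^ n) \<circ> \<phi> a"
proof (induction n)
  case 0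
  then show ?case by simp
next
  case (Suc n)
  let ?b = "((\<lambda>a. a \<triangleright>\<^bsub>X\<^esub> i) ^^ n) a"
  have "?b \<in> carrier X"
    by (rule quandle.rmult_funpow_closed[OF assms(1,4,5)])
  then have "\<phi> (?b \<triangleright>\<^bsub>X\<^esub> i) \<circ> \<phi> i = \<phi> i \<circ> \<phi> ?b"
    by (rule quandle_rep_intertwine[OF assms(2,3) _ assms(5)])
  with Suc show ?case
    by (simp add: fun_eq_iff)
qed

lemma (in cyclic_quandle) rep_funpow_scalar:
  fixes \<phi> :: "'a \<Rightarrow> 'k::field ^ 2 \<Rightarrow> 'k ^ 2"
  assumes rep: "quandle_rep X (*s) \<phi>" and nonconst: "\<not> \<phi> constant_on carrier X"
    and i: "i \<in> carrier X"
  shows "\<exists>c. \<phi> i ^^ (card (carrier X) - 1) = (\<lambda>v. c *s v)"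
proof -
  let ?f = "\<phi> i ^^ (card (carrier X) - 1)"
  have vs: "vector_space ((*s) :: 'k \<Rightarrow> 'k ^ 2 \<Rightarrow> 'k ^ 2)"
    by (rule vec.vector_space_axioms)
  have lin: "Vector_Spaces.linear (*s) (*s) (\<phi> a)" and bij: "bij (\<phi> a)" if "a \<in> carrier X" for a
    using rep that by (auto simp: quandle_rep_def quandle_hom_def Conj_def Aut_def)
  \<comment> \<open>Non-constancy yields a right multiplication that changes a value of
    \<open>\<phi>\<close>; the values at \<open>a\<close> and \<open>j\<close> will be the
    non-commuting pair.\<close>
  obtain a j where aj: "a \<in> carrier X" "j \<in> carrier X" "\<phi> (a \<triangleright> j) \<noteq> \<phi> a"
    using constant_on_if_rmult_invariant[of \<phi>] nonconst by metis
  have "\<phi> a \<circ> \<phi> j \<noteq> \<phi> j \<circ> \<phi> a"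
  proof
    assume "\<phi> a \<circ> \<phi> j = \<phi> j \<circ> \<phi> a"
    then have "\<phi> (a \<triangleright> j) \<circ> \<phi> j = \<phi> a \<circ> \<phi> j"
      using quandle_rep_intertwine[OF vs rep aj(1,2)] by simp
    then have "\<phi> (a \<triangleright> j) = \<phi> a"
      \<comment> \<open>Surjectivity of \<open>\<phi> j\<close> allows it to be cancelled on the
        right.\<close>
      using bij_is_surj[OF bij[OF aj(2)]] by (metis comp_assoc comp_id surj_iff)
    then show False
      using aj(3) by blast
  qed
  \<comment> \<open>The exponent is one at which right multiplication by \<open>i\<close> is the
    identity, so intertwining becomes commuting.\<close>
  moreover have "?f \<circ> \<phi> u = \<phi> u \<circ> ?f" if "u \<in> carrier X" for u
    using quandle_rep_intertwine_funpow[OF quandle_axioms vs rep that i, of "card (carrier X) - 1"]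
      rmult_funpow_card[OF i that] by simp
  ultimately show ?thesis
    using commuting_linear_2[of ?f "\<phi> a" "\<phi> j"] linear_funpow[OF vs lin[OF i]] lin aj(1,2) by blast
qed

lemma standard_generators_carrier:
  assumes "standard_generators X x y"
  shows "x \<in> carrier X" "y \<in> carrier X"
proof -
  obtain F :: "nat ring" and \<alpha> f where "field F"
      and f: "f \<in> quandle_iso (alexander_quandle F \<alpha>) X" "f \<zero>\<^bsub>F\<^esub> = x" "f \<one>\<^bsub>F\<^esub> = y"
    using assms unfolding standard_generators_def by (elim exE conjE) (rule that; assumption)
  interpret field F by fact
  have "f \<in> carrier F \<rightarrow> carrier X"
    using f(1) by (simp add: quandle_iso_def quandle_hom_def alexander_quandle_def)
  then show "x \<in> carrier X" "y \<in> carrier X"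
    using f(2,3) by auto
qed

theorem theorem6p1:
  fixes X :: "'a quandle" and q :: nat and x y :: 'a
    and \<phi> :: "'a \<Rightarrow> complex ^ 2 \<Rightarrow> complex ^ 2" and A B :: "complex ^ 2 \<Rightarrow> complex ^ 2"
  assumes "cyclic_quandle X"
    and "card (carrier X) = q"
    and "q \<ge> 3"
    and "standard_generators X x y"
    and "quandle_rep X ((*s) :: complex \<Rightarrow> complex ^ 2 \<Rightarrow> complex ^ 2) \<phi>"
    and "\<not> \<phi> constant_on carrier X"
    and "A = \<phi> x"
    and "B = \<phi> y"
  shows "irreducible_rep X ((*s) :: complex \<Rightarrow> complex ^ 2 \<Rightarrow> complex ^ 2) \<phi> \<or>
         ((\<exists>a. A ^^ (q - 1) = (\<lambda>v. a *s v)) \<and> (\<exists>b. B ^^ (q - 1) = (\<lambda>v. b *s v)))"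
proof -
  interpret cyclic_quandle X by fact
  show ?thesis
    using rep_funpow_scalar[OF assms(5,6) standard_generators_carrier(1)[OF assms(4)]]
      rep_funpow_scalar[OF assms(5,6) standard_generators_carrier(2)[OF assms(4)]]
    unfolding assms(2,7,8) by (rule disjI2[OF conjI])
qed

end
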